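(* Let $d\ge 1$ be an arbitrary integer. Both $d$-dimensional grids and $d$-dimensional full grids are inversion-free proper $3^{d-1}$-mixed-thin.
   Context: Graphs are finite and simple. A *$d$-dimensional grid* is the Cartesian product of $d\ge1$ paths: vertices are integer points $\vec a=(a_1,\ldots,a_d)$ of a box $\prod_{i=1}^d\{1,\ldots,m_i\}$, and $\vec a,\vec b$ are adjacent iff $\sum_{i=1}^d|a_i-b_i|=1$. A *$d$-dimensional full grid* is the strong product of $d\ge1$ paths: same vertex set, and $\vec a,\vec b$ are adjacent iff $\max_{1\le i\le d}|a_i-b_i|=1$. **Inversion-free proper $k$-mixed-thin.** Let $G=(V,E)$ be a graph, $k>0$ an integer, and $\bar E=\binom{V}{2}\setminus E$. $G$ is *inversion-free proper $k$-mixed-thin* if there exist a partition $(V_1,\ldots,V_k)$ of $V$ and, for each $1\le i\le j\le k$, a linear order $\le_{ij}$ on $V_i\cup V_j$ and a choice of $E_{i,j}\in\{E,\bar E\}$ such that for every $1\le i\le j\le k$ (writing $\lneq_{ij}$ for the strict order): (a') the restriction of $\le_{ij}$ to $V_i$ (resp. to $V_j$) is equal to $\le_{ii}$ (resp. $\le_{jj}$); (b) for every triple $u,v,w$ such that ($\{u,v\}\subseteq V_i$ and $w\in V_j$) or ($\{u,v\}\subseteq V_j$ and $w\in V_i$): if $u\lneq_{ij}v\lneq_{ij}w$ and $uw\in E_{i,j}$, then $vw\in E_{i,j}$; (c) for every triple $u,v,w$ such that ($\{v,w\}\subseteq V_i$ and $u\in V_j$) or ($\{v,w\}\subseteq V_j$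 and $u\in V_i$): if $u\lneq_{ij}v\lneq_{ij}w$ and $uw\in E_{i,j}$, then $uv\in E_{i,j}$. (Parts of the partition are allowed to be empty.) *)

theory Defs
  imports Main "HOL-Library.FuncSet" "HOL-Library.Disjoint_Sets" "HOL-Library.Ramsey"
begin

type_synonym 'a graph = "'a set \<times> 'a set set"

definition simple_graph :: "'a graph \<Rightarrow> bool" where
  "simple_graph G \<longleftrightarrow> (case G of (V, E) \<Rightarrow> finite V \<and> E \<subseteq> [V]\<^bsup>2\<^esup>)"

text \<open>Points of the box are functions on \<open>{1..d}\<close> that are \<open>undefined\<close> elsewhere, so that
  distinct functions are distinct points.\<close>

definition box_points :: "nat \<Rightarrow> (nat \<Rightarrow> nat) \<Rightarrow> (nat \<Rightarrow> int) set" where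
  "box_points d m = (\<Pi>\<^sub>E i\<in>{1..d}. {1..int (m i)})"

definition grid :: "nat \<Rightarrow> (nat \<Rightarrow> nat) \<Rightarrow> (nat \<Rightarrow> int) graph" where
  "grid d m = (box_points d m,
     {{a, b} | a b. a \<in> box_points d m \<and> b \<in> box_points d m \<and>
        (\<Sum>i = 1..d. \<bar>a i - b i\<bar>) = 1})"

definition full_grid :: "nat \<Rightarrow> (nat \<Rightarrow> nat) \<Rightarrow> (nat \<Rightarrow> int) graph" where
  "full_grid d m = (box_points d m,
     {{a, b} | a b. a \<in> box_points d m \<and> b \<in> box_points d m \<and>
        Max ((\<lambda>i. \<bar>a i - b i\<bar>) ` {1..d}) = 1})"

definition strictly_below :: "('a \<times> 'a) set \<Rightarrow> 'a \<Rightarrow> 'a \<Rightarrow> bool" where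
  "strictly_below r x y \<longleftrightarrow> (x, y) \<in> r \<and> x \<noteq> y"

text \<open>Below, \<open>P i\<close> is the part \<open>V\<^sub>i\<close> (possibly empty), \<open>L i j\<close> the order \<open>\<le>\<^sub>i\<^sub>j\<close>, and
  \<open>F i j\<close> the chosen edge set \<open>E\<^sub>i\<^sub>,\<^sub>j\<close>. Only the values at \<open>1 \<le> i \<le> j \<le> k\<close> matter.\<close>

definition inversion_free_proper_mixed_thin :: "nat \<Rightarrow> 'a graph \<Rightarrow> bool" where
  "inversion_free_proper_mixed_thin k G \<longleftrightarrow> simple_graph G \<and> k > 0 \<and> (case G of (V, E) \<Rightarrow>
     (\<exists>(P :: nat \<Rightarrow> 'a set) (L :: nat \<Rightarrow> nat \<Rightarrow> ('a \<times> 'a) set) (F :: nat \<Rightarrow> nat \<Rightarrow> 'a set set).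
        (\<Union>i\<in>{1..k}. P i) = V \<and> disjoint_family_on P {1..k} \<and>
        (\<forall>i j. 1 \<le> i \<and> i \<le> j \<and> j \<le> k \<longrightarrow>
           linear_order_on (P i \<union> P j) (L i j) \<and>
           F i j \<in> {E, [V]\<^bsup>2\<^esup> - E} \<and>
           Restr (L i j) (P i) = L i i \<and> Restr (L i j) (P j) = L j j \<and>
           (\<forall>u v w. ({u, v} \<subseteq> P i \<and> w \<in> P j \<or> {u, v} \<subseteq> P j \<and> w \<in> P i) \<longrightarrow>
              strictly_below (L i j) u v \<longrightarrow> strictly_below (L i j) v w \<longrightarrow>
              {u, w} \<in> F i j \<longrightarrow> {v, w} \<in> F i j) \<and>
           (\<forall>u v w. ({v, w} \<subseteq> P i \<and> u \<in> P j \<or> {v, w} \<subseteq> P j \<and> u \<in> P i) \<longrightarrow>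
              strictly_below (L i j) u v \<longrightarrow> strictly_below (L i j) v w \<longrightarrow>
              {u, w} \<in> F i j \<longrightarrow> {u, v} \<in> F i j))))"

end

theory Submission
  imports Defs
begin

text \<open>Split the vertices by the residues modulo 3 of their first \<open>d - 1\<close> coordinates. For two
  parts there is a single shift \<open>\<delta> \<in> {-1,0,1}\<close> of these coordinates that carries any vertex of the
  first part to the only line in direction \<open>d\<close> of the second part in which it can have neighbours.
  The order of a pair of parts is the lexicographic order after shifting the first part by \<open>\<delta>\<close>.
  Shifts preserve it, so there are no inversions, and what is left is the interleaving of two
  paths. Reading points as numbers in a large base \<open>B\<close> turns the lexicographic order into the
  order of the integers, and the last coordinate into the units.\<close>

section \<open>Mixed-thinness from integer ranks and pairwise shifts\<close>

lemma linear_order_on_inj_key: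
  fixes f :: "'a \<Rightarrow> 'b::linorder"
  assumes "inj_on f A"
  shows "linear_order_on A {(x, y). x \<in> A \<and> y \<in> A \<and> f x \<le> f y}"
  using assms
  by (auto simp: linear_order_on_def partial_order_on_def preorder_on_def refl_on_def trans_def
      antisym_def total_on_def inj_on_def)

text \<open>The number \<open>s i j\<close> is the shift of the part \<open>P i\<close> against \<open>P j\<close>; on shifted ties,
  \<open>P i\<close> precedes \<open>P j\<close>.\<close>

lemma inversion_free_proper_mixed_thin_shiftI:
  fixes r :: "'a \<Rightarrow> int" and s :: "nat \<Rightarrow> nat \<Rightarrow> int"
  assumes graph: "simple_graph (V, E)" and k: "k > 0"
    and cover: "(\<Union>i\<in>{1..k}. P i) = V" and disj: "disjoint_family_on P {1..k}"
    and inj: "inj_on r V" and s_refl: "\<And>i. s i i = 0"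
    and near: "\<And>i j x y. \<lbrakk>i \<in> {1..k}; j \<in> {1..k}; x \<in> P i; y \<in> P j; {x, y} \<in> E\<rbrakk>
        \<Longrightarrow> \<bar>r x + s i j - r y\<bar> \<le> 1"
    and pair: "\<And>i j. \<lbrakk>i \<in> {1..k}; j \<in> {1..k}; i \<noteq> j\<rbrakk> \<Longrightarrow>
        (\<forall>x\<in>P i. \<forall>y\<in>P j. {x, y} \<in> E \<longrightarrow> r x + s i j = r y) \<or>
        (\<forall>x\<in>P i. \<forall>y\<in>P j. \<bar>r x + s i j - r y\<bar> \<le> 1 \<longrightarrow> {x, y} \<in> E)"
  shows "inversion_free_proper_mixed_thin k (V, E)"
proof -
  \<comment> \<open>Doubling leaves room for a tie-break: for \<open>i \<noteq> j\<close> the keys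
    are even on \<open>P i\<close> and odd on \<open>P j\<close>. For \<open>i = j\<close> the shift
    vanishes and all keys are odd.\<close>
  define f where "f i j x =
      2 * (r x + (if x \<in> P i then s i j else 0)) + (if x \<in> P j then 1 else 0)" for i j x
  define L where "L i j = {(x, y). x \<in> P i \<union> P j \<and> y \<in> P i \<union> P j \<and> f i j x \<le> f i j y}" for i j
  have main: "linear_order_on (P i \<union> P j) (L i j) \<and> E \<in> {E, [V]\<^bsup>2\<^esup> - E} \<and>
           Restr (L i j) (P i) = L i i \<and> Restr (L i j) (P j) = L j j \<and>
           (\<forall>u v w. ({u, v} \<subseteq> P i \<and> w \<in> P j \<or> {u, v} \<subseteq> P j \<and> w \<in> P i) \<longrightarrow>
              strictly_below (L i j) u v \<longrightarrow> strictly_below (L i j) v w \<longrightarrow>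
              {u, w} \<in> E \<longrightarrow> {v, w} \<in> E) \<and>
           (\<forall>u v w. ({v, w} \<subseteq> P i \<and> u \<in> P j \<or> {v, w} \<subseteq> P j \<and> u \<in> P i) \<longrightarrow>
              strictly_below (L i j) u v \<longrightarrow> strictly_below (L i j) v w \<longrightarrow>
              {u, w} \<in> E \<longrightarrow> {u, v} \<in> E)"
    if ij: "1 \<le> i" "i \<le> j" "j \<le> k" for i j
  proof -
    have ijk: "i \<in> {1..k}" "j \<in> {1..k}" using ij by auto
    have sub: "P i \<subseteq> V" "P j \<subseteq> V" using cover ijk by blast+
    have disjoint: "i = j" if "x \<in> P i" "x \<in> P j" for x
      using disjoint_family_onD[OF disj ijk] that by blast
    have fi: "f i j x = 2 * (r x + s i j) + (if i = j then 1 else 0)" if "x \<in> P i" for x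
      using that disjoint[of x] by (auto simp: f_def)
    have fj: "f i j x = 2 * r x + 1" if "x \<in> P j" for x
      using that disjoint[of x] s_refl[of i] by (auto simp: f_def)
    have rinj: "x = y" if "x \<in> P i \<union> P j" "y \<in> P i \<union> P j" "r x = r y" for x y
      using inj sub that by (meson Un_iff inj_onD subsetD)
    have finj: "x = y" if xy: "x \<in> P i \<union> P j" "y \<in> P i \<union> P j" "f i j x = f i j y" for x y
    proof -
      have "r x = r y" if "i = j \<or> (x \<in> P i \<longleftrightarrow> y \<in> P i)"
        using xy that fi[of x] fi[of y] fj[of x] fj[of y] by (auto split: if_splits)
      \<comment> \<open>Points of two different parts have keys of different parity.\<close>
      moreover have "i = j \<or> (x \<in> P i \<longleftrightarrow> y \<in> P i)"
      proof (rule ccontr)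
        assume "\<not> ?thesis"
        then have "odd (f i j x) \<noteq> odd (f i j y)" using xy(1,2) by (auto simp: fi fj)
        then show False using xy(3) by simp
      qed
      ultimately show ?thesis using xy rinj by blast
    qed
    have lin: "linear_order_on (P i \<union> P j) (L i j)"
      unfolding L_def by (rule linear_order_on_inj_key) (use finj in \<open>auto simp: inj_on_def\<close>)
    \<comment> \<open>On a single part every key is \<open>2 * r\<close> plus a constant, so all the
      orders agree there with the order of \<open>r\<close>.\<close>
    have Ri: "Restr (L i j) (P i) = L i i"
      by (auto simp: L_def fi) (auto simp: f_def s_refl)
    have Rj: "Restr (L i j) (P j) = L j j"
      by (auto simp: L_def fj) (auto simp: f_def s_refl)
    have sb: "strictly_below (L i j) x y \<longleftrightarrow> f i j x < f i j y"
      if "x \<in> P i \<union> P j" "y \<in> P i \<union> P j" for x y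
      using that finj[OF that] by (auto simp: strictly_below_def L_def less_le)
    have near': "\<bar>r x + s i j - r y\<bar> \<le> 1" if "x \<in> P i" "y \<in> P j" "{x, y} \<in> E" for x y
      using near ijk that by blast
    \<comment> \<open>One edge off the alignment refutes the first alternative of
      \<open>pair\<close>, so the second makes all pairs at shifted distance at most 1
      adjacent.\<close>
    have fill: "{x, y} \<in> E"
      if "i \<noteq> j" "x' \<in> P i" "y' \<in> P j" "{x', y'} \<in> E" "r x' + s i j \<noteq> r y'"
        "x \<in> P i" "y \<in> P j" "\<bar>r x + s i j - r y\<bar> \<le> 1" for x y x' y'
      using pair[OF ijk] that by blast
    have b: "{v, w} \<in> E" if m: "{u, v} \<subseteq> P i \<and> w \<in> P j \<or> {u, v} \<subseteq> P j \<and> w \<in> P i"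
      and "strictly_below (L i j) u v" "strictly_below (L i j) v w" and e: "{u, w} \<in> E" for u v w
    proof -
      have lt: "f i j u < f i j v" "f i j v < f i j w" using sb m that(2,3) by auto
      show ?thesis
      proof (cases "i = j")
        case True
        \<comment> \<open>Impossible case: three increasing integer ranks put \<open>u\<close> and
          \<open>w\<close> at distance at least 2, against the edge.\<close>
        then have mem: "u \<in> P j" "v \<in> P j" "w \<in> P j" using m by auto
        then have "r u < r v" "r v < r w" using lt by (simp_all add: fj)
        then show ?thesis using near'[of u w] mem e s_refl[of j] True by simp
      next
        case False
        from m show ?thesis
        proof
          assume "{u, v} \<subseteq> P i \<and> w \<in> P j"
          then have mem: "v \<in> P i" "w \<in> P j" "u \<in> P i" "w \<in> P j" by auto
          moreover have e': "{u, w} \<in> E" using e by (simp add: insert_commute)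
          \<comment> \<open>Ties put \<open>P i\<close> first, so
            \<open>r u + s i j < r v + s i j \<le> r w\<close>. The edge bounds the outer gap by 1,
            hence \<open>v\<close> is aligned with \<open>w\<close>.\<close>
          moreover have "r u + s i j \<noteq> r w" "\<bar>r v + s i j - r w\<bar> \<le> 1"
            using lt near'[OF mem(3,4) e'] mem False by (auto simp: fi fj)
          ultimately have "{v, w} \<in> E" using fill False by blast
          then show ?thesis by (simp add: insert_commute)
        next
          assume "{u, v} \<subseteq> P j \<and> w \<in> P i"
          then have mem: "w \<in> P i" "v \<in> P j" "w \<in> P i" "u \<in> P j" by auto
          moreover have e': "{w, u} \<in> E" using e by (simp add: insert_commute)
          \<comment> \<open>Contradictory case: here the tie-break gives
            \<open>r u < r v < r w + s i j\<close>, a gap of at least 2 across an edge.\<close>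
          moreover have "r w + s i j \<noteq> r u" "\<bar>r w + s i j - r v\<bar> \<le> 1"
            using lt near'[OF mem(3,4) e'] mem False by (auto simp: fi fj)
          ultimately have "{w, v} \<in> E" using fill False by blast
          then show ?thesis by (simp add: insert_commute)
        qed
      qed
    qed
    have c: "{u, v} \<in> E" if m: "{v, w} \<subseteq> P i \<and> u \<in> P j \<or> {v, w} \<subseteq> P j \<and> u \<in> P i"
      and "strictly_below (L i j) u v" "strictly_below (L i j) v w" and e: "{u, w} \<in> E" for u v w
    proof -
      have lt: "f i j u < f i j v" "f i j v < f i j w" using sb m that(2,3) by auto
      show ?thesis
      proof (cases "i = j")
        case True
        then have mem: "u \<in> P j" "v \<in> P j" "w \<in> P j" using m by auto
        then have "r u < r v" "r v < r w" using lt by (simp_all add: fj)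
        then show ?thesis using near'[of u w] mem e s_refl[of j] True by simp
      next
        case False
        from m show ?thesis
        proof
          assume "{v, w} \<subseteq> P i \<and> u \<in> P j"
          then have mem: "v \<in> P i" "u \<in> P j" "w \<in> P i" "u \<in> P j" by auto
          moreover have e': "{w, u} \<in> E" using e by (simp add: insert_commute)
          \<comment> \<open>Contradictory again:
            \<open>r u < r v + s i j < r w + s i j\<close>.\<close>
          moreover have "r w + s i j \<noteq> r u" "\<bar>r v + s i j - r u\<bar> \<le> 1"
            using lt near'[OF mem(3,4) e'] mem False by (auto simp: fi fj)
          ultimately have "{v, u} \<in> E" using fill False by blast
          then show ?thesis by (simp add: insert_commute)
        next
          assume "{v, w} \<subseteq> P j \<and> u \<in> P i"
          then have mem: "u \<in> P i" "v \<in> P j" "u \<in> P i" "w \<in> P j" by auto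
          moreover have e': "{u, w} \<in> E" using e by (simp add: insert_commute)
          \<comment> \<open>Now \<open>r u + s i j \<le> r v < r w\<close> with outer gap at most 1,
            so \<open>u\<close> is aligned with \<open>v\<close>.\<close>
          moreover have "r u + s i j \<noteq> r w" "\<bar>r u + s i j - r v\<bar> \<le> 1"
            using lt near'[OF mem(3,4) e'] mem False by (auto simp: fi fj)
          ultimately have "{u, v} \<in> E" using fill False by blast
          then show ?thesis by (simp add: insert_commute)
        qed
      qed
    qed
    show ?thesis
      by (intro conjI allI impI) (rule insertI1 lin Ri Rj | erule (3) b | erule (3) c)+
  qed
  show ?thesis
    unfolding inversion_free_proper_mixed_thin_def prod.case
    by (rule conjI[OF graph conjI[OF k]], rule exI[of _ P], rule exI[of _ L],
        rule exI[of _ "\<lambda>_ _. E"], rule conjI[OF cover conjI[OF disj]], intro allI impI,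
        elim conjE, rule main)
qed

section \<open>Points as numbers in base \<open>B\<close>\<close>

text \<open>The first coordinate is the most significant digit. Digits may be negative, so the
  encoding is additive and also applies to shifts and differences of points.\<close>

definition radix :: "int \<Rightarrow> nat \<Rightarrow> (nat \<Rightarrow> int) \<Rightarrow> int" where
  "radix B d x = (\<Sum>t = 1..d. x t * B ^ (d - t))"

lemma radix_Suc: "radix B (Suc d) x = B * radix B d x + x (Suc d)"
  by (auto simp: radix_def sum_distrib_left Suc_diff_le mult_ac intro!: sum.cong)

lemma radix_add: "radix B d (\<lambda>t. x t + y t) = radix B d x + radix B d y"
  by (simp add: radix_def sum.distrib distrib_right)

lemma radix_diff: "radix B d (\<lambda>t. x t - y t) = radix B d x - radix B d y"
  by (simp add: radix_def sum_subtractf left_diff_distrib)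

lemma radix_zero: "(\<And>t. t \<in> {1..d} \<Longrightarrow> x t = 0) \<Longrightarrow> radix B d x = 0"
  by (simp add: radix_def)

lemma radix_cong: "(\<And>t. t \<in> {1..d} \<Longrightarrow> x t = y t) \<Longrightarrow> radix B d x = radix B d y"
  by (simp add: radix_def)

lemma radix_last: "1 \<le> d \<Longrightarrow> radix B d (\<lambda>t. if t = d then c else 0) = c"
  by (cases d) (auto simp: radix_Suc intro!: radix_zero)

text \<open>The base divides the last digit, which is smaller than the base in absolute value and so
  is zero; cancel \<open>B\<close> and induct.\<close>

lemma radix_eq_0D:
  assumes "radix B d x = 0" and "\<And>t. t \<in> {1..d} \<Longrightarrow> \<bar>x t\<bar> < B" and "t \<in> {1..d}"
  shows "x t = 0"
  using assms
proof (induction d arbitrary: t)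
  case (Suc d)
  have e: "B * radix B d x + x (Suc d) = 0" using Suc.prems(1) by (simp add: radix_Suc)
  have bd: "\<bar>x (Suc d)\<bar> < B" using Suc.prems(2) by simp
  have "B dvd x (Suc d)" using e by (metis add.commute add_eq_0_iff dvd_minus_iff dvd_triv_left)
  then have x0: "x (Suc d) = 0" using bd dvd_imp_le_int[of "x (Suc d)" B] by fastforce
  then have "radix B d x = 0" using e bd by auto
  then show ?case using Suc.IH[of t] Suc.prems(2,3) x0 by (cases "t = Suc d") auto
qed simp

text \<open>Subtracting \<open>c\<close> from the last digit reduces this to uniqueness of the
  digits of 0; the extra 1 in the bound pays for that subtraction.\<close>

lemma radix_near_iff:
  assumes "1 \<le> d" and B: "\<And>t. t \<in> {1..d} \<Longrightarrow> \<bar>z t\<bar> + 1 < B" and c: "\<bar>c\<bar> \<le> 1"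
  shows "radix B d z = c \<longleftrightarrow> (\<forall>t\<in>{1..<d}. z t = 0) \<and> z d = c"
proof
  assume r: "radix B d z = c"
  let ?w = "\<lambda>t. z t - (if t = d then c else 0)"
  have "radix B d ?w = 0" using r assms(1) by (simp add: radix_diff radix_last)
  moreover have "\<bar>?w t\<bar> < B" if "t \<in> {1..d}" for t using B[OF that] c by auto
  ultimately have "?w t = 0" if "t \<in> {1..d}" for t using that radix_eq_0D[of B d ?w t] by blast
  then show "(\<forall>t\<in>{1..<d}. z t = 0) \<and> z d = c" using assms(1) by fastforce
next
  assume "(\<forall>t\<in>{1..<d}. z t = 0) \<and> z d = c"
  then have "radix B d z = radix B d (\<lambda>t. if t = d then c else 0)" by (intro radix_cong) auto
  then show "radix B d z = c" using assms(1) by (simp add: radix_last)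
qed

section \<open>Edges of grids and full grids\<close>

lemma finite_box_points: "finite (box_points d m)"
  unfolding box_points_def by (intro finite_PiE) auto

lemma grid_edge_iff:
  "{x, y} \<in> snd (grid d m) \<longleftrightarrow> x \<in> box_points d m \<and> y \<in> box_points d m \<and>
     (\<Sum>t = 1..d. \<bar>x t - y t\<bar>) = 1"
  by (auto simp: grid_def doubleton_eq_iff abs_minus_commute)

text \<open>Split the maximum being 1 into two inequalities: the upper one holds in each coordinate,
  and the lower one says that the integer points differ somewhere in the box.\<close>

lemma full_grid_edge_iff:
  assumes "1 \<le> d"
  shows "{x, y} \<in> snd (full_grid d m) \<longleftrightarrow> x \<in> box_points d m \<and> y \<in> box_points d m \<and>
     x \<noteq> y \<and> (\<forall>t\<in>{1..d}. \<bar>x t - y t\<bar> \<le> 1)"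
proof -
  have ne: "(\<lambda>t. \<bar>x t - y t\<bar>) ` {1..d} \<noteq> {}" using assms by auto
  have "{x, y} \<in> snd (full_grid d m) \<longleftrightarrow> x \<in> box_points d m \<and> y \<in> box_points d m \<and>
     Max ((\<lambda>t. \<bar>x t - y t\<bar>) ` {1..d}) = 1"
    by (auto simp: full_grid_def doubleton_eq_iff abs_minus_commute)
  moreover have "Max ((\<lambda>t. \<bar>x t - y t\<bar>) ` {1..d}) = 1 \<longleftrightarrow>
      x \<noteq> y \<and> (\<forall>t\<in>{1..d}. \<bar>x t - y t\<bar> \<le> 1)"
    if "x \<in> box_points d m" "y \<in> box_points d m"
  proof -
    have "x = y" if "\<And>t. t \<in> {1..d} \<Longrightarrow> x t = y t"
      using \<open>x \<in> _\<close> \<open>y \<in> _\<close> that unfolding box_points_def by (rule PiE_ext)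
    then have "x \<noteq> y \<longleftrightarrow> (\<exists>t\<in>{1..d}. x t \<noteq> y t)" by blast
    also have "\<dots> \<longleftrightarrow> (\<exists>t\<in>{1..d}. \<bar>x t - y t\<bar> \<ge> 1)" by (intro bex_cong) auto
    finally have "x \<noteq> y \<longleftrightarrow> (\<exists>t\<in>{1..d}. \<bar>x t - y t\<bar> \<ge> 1)" .
    moreover have "Max ((\<lambda>t. \<bar>x t - y t\<bar>) ` {1..d}) \<le> 1 \<longleftrightarrow> (\<forall>t\<in>{1..d}. \<bar>x t - y t\<bar> \<le> 1)"
      by (subst Max_le_iff) (use ne in blast)+
    moreover have "Max ((\<lambda>t. \<bar>x t - y t\<bar>) ` {1..d}) \<ge> 1 \<longleftrightarrow> (\<exists>t\<in>{1..d}. \<bar>x t - y t\<bar> \<ge> 1)"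
      by (subst Max_ge_iff) (use ne in blast)+
    ultimately show ?thesis unfolding order.eq_iff[of "Max _"] by blast
  qed
  ultimately show ?thesis by blast
qed

lemma simple_graph_grid: "simple_graph (box_points d m, snd (grid d m))"
proof -
  have "e \<in> [box_points d m]\<^bsup>2\<^esup>" if e: "e \<in> snd (grid d m)" for e
  proof -
    obtain x y where xy: "e = {x, y}" using e by (auto simp: grid_def)
    then have "x \<in> box_points d m" "y \<in> box_points d m" "x \<noteq> y"
      using e by (auto simp: grid_edge_iff)
    then show ?thesis using xy by (simp add: nsets_def)
  qed
  then show ?thesis using finite_box_points by (auto simp: simple_graph_def)
qed

lemma simple_graph_full_grid:
  assumes "1 \<le> d"
  shows "simple_graph (box_points d m, snd (full_grid d m))"
proof -
  have "e \<in> [box_points d m]\<^bsup>2\<^esup>" if e: "e \<in> snd (full_grid d m)" for e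
  proof -
    obtain x y where xy: "e = {x, y}" using e by (auto simp: full_grid_def)
    then have "x \<in> box_points d m" "y \<in> box_points d m" "x \<noteq> y"
      using e full_grid_edge_iff[OF assms] by auto
    then show ?thesis using xy by (simp add: nsets_def)
  qed
  then show ?thesis using finite_box_points by (auto simp: simple_graph_def)
qed

text \<open>The only representative in \<open>{-1,0,1}\<close> of \<open>q - p\<close> modulo 3.\<close>

definition shift3 :: "int \<Rightarrow> int \<Rightarrow> int" where
  "shift3 p q = (q - p + 1) mod 3 - 1"

text \<open>The shift depends only on \<open>y - x\<close> modulo 3, and it equals
  \<open>y - x\<close> exactly when that difference is its own representative in {-1,0,1}.\<close>

lemma shift3_eq_iff:
  "\<bar>x - y\<bar> \<le> 1 \<longleftrightarrow> x + shift3 (x mod 3) (y mod 3) = (y::int)"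
proof -
  have "(y mod 3 - x mod 3 + 1) mod 3 = (y - x + 1) mod 3" by presburger
  moreover have "\<bar>z\<bar> \<le> 1 \<longleftrightarrow> (z + 1) mod 3 - 1 = z" for z :: int by presburger
  note this[of "y - x"]
  ultimately show ?thesis unfolding shift3_def by (auto simp: abs_minus_commute)
qed

lemma abs_shift3_le: "\<bar>shift3 p q\<bar> \<le> 1"
  unfolding shift3_def by presburger

lemma shift3_refl: "shift3 p p = 0"
  by (simp add: shift3_def)

section \<open>The residue partition and its ranks for both kinds of grid\<close>

theorem theorem3p4:
  fixes d :: nat and m :: "nat \<Rightarrow> nat"
  assumes "d \<ge> 1"
    and "\<And>i. i \<in> {1..d} \<Longrightarrow> m i \<ge> 1"
  shows "inversion_free_proper_mixed_thin (3 ^ (d - 1)) (grid d m) \<and>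
         inversion_free_proper_mixed_thin (3 ^ (d - 1)) (full_grid d m)"
proof -
  define V where "V = box_points d m"
  define k where "k = (3::nat) ^ (d - 1)"
  \<comment> \<open>The residue vectors that index the parts; \<open>h\<close> numbers them from 1
    to \<open>k\<close>.\<close>
  define R where "R = (\<Pi>\<^sub>E t\<in>{1..<d}. {0..2::int})"
  have "card R = k" unfolding R_def k_def by (subst card_PiE) auto
  moreover have "finite R" unfolding R_def by (intro finite_PiE) auto
  ultimately obtain h where h: "bij_betw h {1..k} R" using ex_bij_betw_nat_finite_1 by blast
  define P where "P i = {x \<in> V. \<forall>t\<in>{1..<d}. x t mod 3 = h i t}" for i
  define \<delta> where "\<delta> i j t = (if t = d then 0 else shift3 (h i t) (h j t))" for i j t
  \<comment> \<open>The differences of coordinates stay below the sum of the side lengths. The added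
    3 leaves room for a shift of 1 and for the slack in \<open>radix_near_iff\<close>.\<close>
  define B where "B = int (\<Sum>t = 1..d. m t) + 3"
  define s where "s i j = radix B d (\<delta> i j)" for i j
  have PV: "x \<in> V" if "x \<in> P i" for x i using that by (simp add: P_def)
  have h_neq: "\<exists>t\<in>{1..<d}. h i t \<noteq> h j t" if "i \<in> {1..k}" "j \<in> {1..k}" "i \<noteq> j" for i j
  proof (rule ccontr)
    assume "\<not> ?thesis"
    then have eq: "\<And>t. t \<in> {1..<d} \<Longrightarrow> h i t = h j t" by blast
    have "h i \<in> R" "h j \<in> R" using bij_betw_apply[OF h] that by blast+
    then have "h i = h j" unfolding R_def using eq by (rule PiE_ext)
    then show False using inj_onD[OF bij_betw_imp_inj_on[OF h]] that by blast
  qed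
  have disj: "disjoint_family_on P {1..k}"
  proof -
    have "P i \<inter> P j = {}" if "i \<in> {1..k}" "j \<in> {1..k}" "i \<noteq> j" for i j
      using h_neq[OF that] unfolding P_def by force
    then show ?thesis unfolding disjoint_family_on_def by blast
  qed
  have cover: "(\<Union>i\<in>{1..k}. P i) = V"
  proof -
    have "\<exists>i\<in>{1..k}. x \<in> P i" if "x \<in> V" for x
    proof -
      have "restrict (\<lambda>t. x t mod 3) {1..<d} \<in> R" by (auto simp: R_def)
      then obtain i where "i \<in> {1..k}" "h i = restrict (\<lambda>t. x t mod 3) {1..<d}"
        unfolding bij_betw_imp_surj_on[OF h, symmetric] by (metis imageE)
      then show ?thesis using that by (intro bexI[of _ i]) (auto simp: P_def)
    qed
    then show ?thesis using PV by blast
  qed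
  have bound: "\<bar>x t - y t\<bar> + 2 < B" if "x \<in> V" "y \<in> V" "t \<in> {1..d}" for x y t
  proof -
    have "m t \<le> (\<Sum>t = 1..d. m t)" using that(3) by (intro member_le_sum) auto
    moreover have "x t \<in> {1..int (m t)}" "y t \<in> {1..int (m t)}"
      using that by (auto simp: V_def box_points_def)
    ultimately show ?thesis unfolding B_def atLeastAtMost_iff by linarith
  qed
  have inj: "inj_on (radix B d) V"
  proof (rule inj_onI)
    fix x y assume xy: "x \<in> V" "y \<in> V" "radix B d x = radix B d y"
    have "radix B d (\<lambda>t. x t - y t) = 0" using xy(3) by (simp add: radix_diff)
    moreover have "\<bar>x t - y t\<bar> < B" if "t \<in> {1..d}" for t using bound[OF xy(1,2) that] by simp
    ultimately have "x t - y t = 0" if "t \<in> {1..d}" for t using that by (rule radix_eq_0D)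
    then have "\<And>t. t \<in> {1..d} \<Longrightarrow> x t = y t" by simp
    with xy(1,2) show "x = y" unfolding V_def box_points_def by (rule PiE_ext)
  qed
  have s_refl: "s i i = 0" for i by (auto simp: s_def \<delta>_def shift3_refl intro: radix_zero)
  \<comment> \<open>The left side encodes the digits \<open>x t + \<delta> i j t - y t\<close>. For
    \<open>t < d\<close> such a digit vanishes exactly when \<open>x t\<close> and
    \<open>y t\<close> are within 1, since \<open>\<delta>\<close> is computed from their
    residues.\<close>
  have diff: "radix B d x + s i j - radix B d y = c \<longleftrightarrow>
      (\<forall>t\<in>{1..<d}. \<bar>x t - y t\<bar> \<le> 1) \<and> x d - y d = c"
    if xy: "x \<in> P i" "y \<in> P j" and c: "\<bar>c\<bar> \<le> 1" for x y i j c
  proof -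
    let ?z = "\<lambda>t. x t + \<delta> i j t - y t"
    have z: "\<bar>?z t\<bar> + 1 < B" if "t \<in> {1..d}" for t
    proof -
      have "\<bar>\<delta> i j t\<bar> \<le> 1" by (simp add: \<delta>_def abs_shift3_le)
      then show ?thesis using bound[OF PV[OF xy(1)] PV[OF xy(2)] that] by linarith
    qed
    have near0: "?z t = 0 \<longleftrightarrow> \<bar>x t - y t\<bar> \<le> 1" if "t \<in> {1..<d}" for t
    proof -
      have "x t mod 3 = h i t" "y t mod 3 = h j t" using xy that by (simp_all add: P_def)
      then show ?thesis using that shift3_eq_iff[of "x t" "y t"] by (simp add: \<delta>_def)
    qed
    have "radix B d x + s i j - radix B d y = radix B d ?z"
      by (simp add: s_def radix_add radix_diff)
    also have "\<dots> = c \<longleftrightarrow> (\<forall>t\<in>{1..<d}. ?z t = 0) \<and> ?z d = c"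
      using assms(1) z c by (rule radix_near_iff)
    also have "\<dots> \<longleftrightarrow> (\<forall>t\<in>{1..<d}. \<bar>x t - y t\<bar> \<le> 1) \<and> x d - y d = c"
      using near0 by (simp add: \<delta>_def)
    finally show ?thesis .
  qed
  have near: "\<bar>radix B d x + s i j - radix B d y\<bar> \<le> 1 \<longleftrightarrow> (\<forall>t\<in>{1..d}. \<bar>x t - y t\<bar> \<le> 1)"
    if "x \<in> P i" "y \<in> P j" for x y i j
  proof -
    have "{1..d} = insert d {1..<d}" using assms(1) by auto
    then have "(\<forall>t\<in>{1..d}. \<bar>x t - y t\<bar> \<le> 1) \<longleftrightarrow>
        (\<forall>t\<in>{1..<d}. \<bar>x t - y t\<bar> \<le> 1) \<and> \<bar>x d - y d\<bar> \<le> 1"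
      by (simp only: ball_simps conj_commute)
    also have "\<dots> \<longleftrightarrow> (\<exists>c. \<bar>c\<bar> \<le> 1 \<and> (\<forall>t\<in>{1..<d}. \<bar>x t - y t\<bar> \<le> 1) \<and> x d - y d = c)"
      by blast
    also have "\<dots> \<longleftrightarrow> (\<exists>c. \<bar>c\<bar> \<le> 1 \<and> radix B d x + s i j - radix B d y = c)"
      using diff[OF that] by blast
    finally show ?thesis by blast
  qed
  have grid_le: "\<bar>x t - y t\<bar> \<le> 1" if "{x, y} \<in> snd (grid d m)" "t \<in> {1..d}" for x y t
    using that member_le_sum[of t "{1..d}" "\<lambda>t. \<bar>x t - y t\<bar>"] by (auto simp: grid_edge_iff)
  have grid_eq: "radix B d x + s i j = radix B d y"
    if ij: "i \<in> {1..k}" "j \<in> {1..k}" "i \<noteq> j" and xy: "x \<in> P i" "y \<in> P j"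
      and e: "{x, y} \<in> snd (grid d m)" for i j x y
  proof -
    \<comment> \<open>A coordinate with different residues already uses up the whole distance 1, so
      the last coordinates agree and the edge is aligned.\<close>
    obtain t where t: "t \<in> {1..<d}" "h i t \<noteq> h j t" using h_neq ij by blast
    have "x t mod 3 = h i t" "y t mod 3 = h j t" using xy t(1) by (simp_all add: P_def)
    then have "x t \<noteq> y t" using t(2) by metis
    moreover have "(\<Sum>t\<in>{t, d}. \<bar>x t - y t\<bar>) \<le> (\<Sum>t = 1..d. \<bar>x t - y t\<bar>)"
      using t by (intro sum_mono2) auto
    moreover have "(\<Sum>t = 1..d. \<bar>x t - y t\<bar>) = 1" using e by (simp only: grid_edge_iff)
    ultimately have "x d - y d = 0" using t(1) by simp
    moreover have "\<forall>t\<in>{1..<d}. \<bar>x t - y t\<bar> \<le> 1" using grid_le[OF e] by simp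
    ultimately show ?thesis using diff[OF xy, of 0] by simp
  qed
  have k_pos: "k > 0" by (simp add: k_def)
  have "inversion_free_proper_mixed_thin k (V, snd (grid d m))"
  proof (rule inversion_free_proper_mixed_thin_shiftI[OF _ k_pos cover disj inj s_refl])
    show "simple_graph (V, snd (grid d m))" unfolding V_def by (rule simple_graph_grid)
    show "\<bar>radix B d x + s i j - radix B d y\<bar> \<le> 1"
      if "x \<in> P i" "y \<in> P j" "{x, y} \<in> snd (grid d m)" for i j x y
      using near[OF that(1,2)] grid_le[OF that(3)] by blast
  \<comment> \<open>For grids every edge between different parts is aligned: the first alternative
    of the criterion.\<close>
  qed (use grid_eq in blast)
  moreover have "inversion_free_proper_mixed_thin k (V, snd (full_grid d m))"
  proof (rule inversion_free_proper_mixed_thin_shiftI[OF _ k_pos cover disj inj s_refl])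
    show "simple_graph (V, snd (full_grid d m))"
      unfolding V_def using assms(1) by (rule simple_graph_full_grid)
    show "\<bar>radix B d x + s i j - radix B d y\<bar> \<le> 1"
      if "x \<in> P i" "y \<in> P j" "{x, y} \<in> snd (full_grid d m)" for i j x y
      using near[OF that(1,2)] that(3) full_grid_edge_iff[OF assms(1)] by blast
    show "(\<forall>x\<in>P i. \<forall>y\<in>P j. {x, y} \<in> snd (full_grid d m) \<longrightarrow> radix B d x + s i j = radix B d y) \<or>
        (\<forall>x\<in>P i. \<forall>y\<in>P j. \<bar>radix B d x + s i j - radix B d y\<bar> \<le> 1 \<longrightarrow> {x, y} \<in> snd (full_grid d m))"
      if ij: "i \<in> {1..k}" "j \<in> {1..k}" "i \<noteq> j" for i j
    \<comment> \<open>For full grids, ranks within 1 after shifting mean that all coordinates are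
      within 1. That is adjacency once the points differ, and disjoint parts ensure this.\<close>
    proof (intro disjI2 ballI impI)
      fix x y
      assume xy: "x \<in> P i" "y \<in> P j" and le: "\<bar>radix B d x + s i j - radix B d y\<bar> \<le> 1"
      have "x \<noteq> y" using disjoint_family_onD[OF disj ij] xy by blast
      then show "{x, y} \<in> snd (full_grid d m)"
        using near[OF xy] le PV[OF xy(1)] PV[OF xy(2)] full_grid_edge_iff[OF assms(1)]
        unfolding V_def by blast
    qed
  qed
  ultimately show ?thesis by (simp add: V_def k_def grid_def full_grid_def)
qed

end
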